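(* For each convex body $A\in\mathcal{C}^n$, there exist a unique $B\in\mathcal{C}^n_{\mathsf{i}}$ and a unique $B_\lambda\in\mathcal{B}^n$ such that $A=B+B_\lambda$. Moreover, the correspondence $$A\mapsto(A_{-\lambda_A},B_{\lambda_A})$$ establishes a bijection between $\mathcal{C}^n$ and $\mathcal{C}^n_{\mathsf{i}}\times\mathcal{B}^n$, whose inverse is given by $(B,B_\lambda)\mapsto B+B_\lambda$.
   Context: Let $n\geq 1$. A convex body in $\mathbb{R}^n$ is a nonempty, compact and convex subset of $\mathbb{R}^n$; $\mathcal{C}^n$ is the set of all convex bodies in $\mathbb{R}^n$. The Minkowski sum is $B+C=\{b+c\mid b\in B,c\in C\}$. $B_\lambda$ denotes the closed ball of radius $\lambda\geq 0$ centered at the origin, and $\mathcal{B}^n$ is the set of all such closed balls (including radius $0$). For $A\in\mathcal{C}^n$ and $\lambda\geq 0$, the inner parallel body of $A$ at distance $\lambda$ is $A_{-\lambda}=\{t\in\mathbb{R}^n\mid t+B_\lambda\subseteq A\}$; a nonempty $A_{-\lambda}$ is called regular if $A=A_{-\lambda}+B_\lambda$. Put $\Lambda_A:=\{\lambda\geq 0\mid A_{-\lambda}\text{ is a regular inner parallel body of }A\}$ and $\lambda_A:=\sup\Lambda_A$. A convex body $A$ is irreducible if $A=A_{-\lambda_A}$, i.e., if $A$ has no non-trivial regular inner parallel body (one with $\lambda>0$). $\mathcal{C}^n_{\mathsf{i}}$ is the set of irreducible convex bodies in $\mathbb{R}^n$. *)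

theory Defs
  imports "HOL-Analysis.Analysis"
begin

text \<open>The Minkowski sum is the pointwise addition of sets from \<^theory>\<open>HOL-Library.Set_Algebras\<close>,
  written \<open>+\<close>.\<close>

definition convex_bodies :: "(real ^ 'n) set set" where
  "convex_bodies = {A. A \<noteq> {} \<and> compact A \<and> convex A}"

definition centered_balls :: "(real ^ 'n) set set" where
  "centered_balls = {cball 0 r | r. 0 \<le> r}"

text \<open>Only meaningful for \<open>0 \<le> r\<close>: for \<open>r < 0\<close> the set \<open>cball 0 r\<close> is empty.\<close>

definition inner_parallel_body :: "(real ^ 'n) set \<Rightarrow> real \<Rightarrow> (real ^ 'n) set" where
  "inner_parallel_body A r = {t. (\<lambda>b. t + b) ` cball 0 r \<subseteq> A}"

definition regular_radii :: "(real ^ 'n) set \<Rightarrow> real set" where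
  "regular_radii A = {r. 0 \<le> r \<and> inner_parallel_body A r \<noteq> {} \<and>
     A = inner_parallel_body A r + cball 0 r}"

text \<open>For a convex body \<open>A\<close>, the set \<open>regular_radii A\<close> contains 0 and is bounded above by the
  diameter of \<open>A\<close> (the dimension is at least 1), so this is a supremum in the usual sense.\<close>

definition max_regular_radius :: "(real ^ 'n) set \<Rightarrow> real" where
  "max_regular_radius A = Sup (regular_radii A)"

definition irreducible_bodies :: "(real ^ 'n) set set" where
  "irreducible_bodies =
     {A \<in> convex_bodies. A = inner_parallel_body A (max_regular_radius A)}"

definition decompose :: "(real ^ 'n) set \<Rightarrow> (real ^ 'n) set \<times> (real ^ 'n) set" where
  "decompose A =
     (inner_parallel_body A (max_regular_radius A), cball 0 (max_regular_radius A))"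

end

theory Submission
  imports Defs
begin

text \<open>
  Minkowski cancellation ties inner parallel bodies to sums: for a closed convex \<open>C\<close> and a
  nonempty compact \<open>D\<close>, a translate of \<open>D\<close> that fits into \<open>C + D\<close> is a translate by a point of \<open>C\<close>
  (lemma \<open>minkowski_cancellation\<close>, by separating the translation vector from \<open>C\<close>). Hence
  \<open>A = K + cball 0 r\<close> with a convex body \<open>K\<close> forces \<open>K\<close> to be the inner parallel body of \<open>A\<close> at
  distance \<open>r\<close>, and the regular radii of \<open>A\<close> are exactly the \<open>r\<close> for which \<open>cball 0 r\<close> is a
  Minkowski summand of \<open>A\<close> with a convex body as complement (\<open>regular_radii_eq\<close>).

  By compactness the supremum of the regular radii is itself a regular radius
  (\<open>max_regular_radius_regular\<close>), so every body splits off a largest ball. By cancellation, a body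
  equal to its sum with \<open>cball 0 r\<close> has \<open>r = 0\<close>, so irreducibility means that \<open>0\<close> is the only
  regular radius (\<open>irreducible_bodies_iff\<close>). As radii of balls add under Minkowski sums, what
  remains after splitting off the largest ball is irreducible. Conversely, if
  \<open>A = B + cball 0 r\<close> with \<open>B\<close> irreducible, then \<open>r\<close> is a regular radius of \<open>A\<close>, and the
  largest one cannot be some \<open>s > r\<close>, for then \<open>cball 0 (s - r)\<close> could be split off from \<open>B\<close>.
  So \<open>decompose\<close> is a two-sided inverse of Minkowski addition on pairs of an irreducible body and
  a centred ball, and everything follows.
\<close>

section \<open>Minkowski sums and cancellation\<close>

text \<open>A functional that separates \<open>t\<close> from \<open>C\<close> would, at a point of \<open>D\<close> where it is minimal, also
  separate the corresponding point of \<open>t + D\<close> from \<open>C + D\<close>.\<close>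

lemma minkowski_cancellation:
  fixes C D :: "'a::euclidean_space set"
  assumes C: "closed C" "convex C" and D: "compact D" "D \<noteq> {}"
    and sub: "\<And>d. d \<in> D \<Longrightarrow> t + d \<in> C + D"
  shows "t \<in> C"
proof (rule ccontr)
  assume "t \<notin> C"
  with C obtain a b where ab: "inner a t < b" "\<And>x. x \<in> C \<Longrightarrow> inner a x > b"
    using separating_hyperplane_closed_point[OF C(2,1)] by metis
  have "continuous_on D (inner a)"
    by (intro continuous_intros)
  then obtain d where d: "d \<in> D" "\<And>y. y \<in> D \<Longrightarrow> inner a d \<le> inner a y"
    using continuous_attains_inf[OF D, of "inner a"] by metis
  from sub[OF d(1)] obtain c d' where cd: "t + d = c + d'" "c \<in> C" "d' \<in> D"
    by (rule set_plus_elim)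
  from cd(1) have "inner a t + inner a d = inner a c + inner a d'"
    by (simp flip: inner_add_right)
  with ab(1) ab(2)[OF cd(2)] d(2)[OF cd(3)] show False
    by linarith
qed

lemma cball_0_plus_cball_0:
  fixes r s :: real
  assumes "0 \<le> r" "0 \<le> s"
  shows "cball (0::'a::real_normed_vector) r + cball 0 s = cball 0 (r + s)"
proof
  show "cball (0::'a) r + cball 0 s \<subseteq> cball 0 (r + s)"
  proof
    fix x :: 'a
    assume "x \<in> cball 0 r + cball 0 s"
    then obtain a b where "x = a + b" "norm a \<le> r" "norm b \<le> s"
      by (auto elim!: set_plus_elim)
    then show "x \<in> cball 0 (r + s)"
      by (simp add: norm_triangle_mono)
  qed
next
  show "cball (0::'a) (r + s) \<subseteq> cball 0 r + cball 0 s"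
  proof
    fix x :: 'a
    assume "x \<in> cball 0 (r + s)"
    then have x: "norm x \<le> r + s" by simp
    show "x \<in> cball 0 r + cball 0 s"
    proof (cases "r + s = 0")
      case True
      with assms x have "x = 0 + 0" "r = 0" "s = 0" by auto
      then show ?thesis by (simp only:) (rule set_plus_intro; simp)
    next
      case False
      with assms have pos: "0 < r + s" by linarith
      have part: "(c / (r + s)) *\<^sub>R x \<in> cball 0 c" if "0 \<le> c" for c
        using mult_left_mono[OF x that] pos that by (simp add: pos_divide_le_eq)
      have "(r / (r + s)) *\<^sub>R x + (s / (r + s)) *\<^sub>R x = ((r + s) / (r + s)) *\<^sub>R x"
        by (simp only: scaleR_add_left add_divide_distrib)
      also have "\<dots> = x"
        using pos by simp
      finally show ?thesis
        using set_plus_intro[OF part[OF assms(1)] part[OF assms(2)]] by (simp only:)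
    qed
  qed
qed

lemma convex_bodies_plus:
  assumes "A \<in> convex_bodies" "B \<in> convex_bodies"
  shows "A + B \<in> convex_bodies"
proof -
  have "A + B = {x + y | x y. x \<in> A \<and> y \<in> B}"
    by (auto simp: set_plus_def)
  then have "compact (A + B)"
    using assms compact_sums[of A B] by (simp add: convex_bodies_def)
  moreover have "A + B \<noteq> {}"
    using assms by (auto simp: convex_bodies_def)
  ultimately show ?thesis
    using assms by (simp add: convex_bodies_def convex_set_plus)
qed

lemma cball_in_convex_bodies: "0 \<le> r \<Longrightarrow> cball 0 r \<in> convex_bodies"
  by (simp add: convex_bodies_def)

text \<open>Cancelling \<open>A\<close> in \<open>A + cball 0 r \<subseteq> A + {0}\<close> leaves \<open>cball 0 r \<subseteq> {0}\<close>.\<close>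

lemma absorbed_cball_trivial:
  fixes A :: "(real ^ 'n) set"
  assumes A: "A \<in> convex_bodies" and eq: "A = A + cball 0 r" and r: "0 \<le> r"
  shows "r = 0"
proof -
  obtain u :: "real ^ 'n" where u: "norm u = r"
    using vector_choose_size[OF r] by blast
  have "u \<in> {0}"
  proof (rule minkowski_cancellation)
    show "compact A" "A \<noteq> {}" using A by (auto simp: convex_bodies_def)
    fix d assume "d \<in> A"
    then have "d + u \<in> A + cball 0 r"
      by (rule set_plus_intro) (simp add: u)
    then have "d + u \<in> A"
      by (simp flip: eq)
    then have "0 + (d + u) \<in> {0} + A"
      by (intro set_plus_intro) simp_all
    then show "u + d \<in> {0} + A"
      by (simp only: add_0_left add.commute)
  qed simp_all
  with u show ?thesis by simp
qed

section \<open>Regular radii as radii of ball summands\<close>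

lemma mem_inner_parallel_body:
  "t \<in> inner_parallel_body A r \<longleftrightarrow> (\<forall>b. norm b \<le> r \<longrightarrow> t + b \<in> A)"
  unfolding inner_parallel_body_def image_subset_iff by (simp add: Ball_def)

lemma inner_parallel_body_subset:
  assumes "0 \<le> r"
  shows "inner_parallel_body A r \<subseteq> A"
proof
  fix t assume "t \<in> inner_parallel_body A r"
  then have "norm b \<le> r \<Longrightarrow> t + b \<in> A" for b
    by (simp add: mem_inner_parallel_body)
  from this[of 0] assms show "t \<in> A" by simp
qed

lemma inner_parallel_body_0: "inner_parallel_body A 0 = A"
  by (auto simp: mem_inner_parallel_body)

lemma inner_parallel_body_plus_subset: "inner_parallel_body A r + cball 0 r \<subseteq> A"
  by (auto simp: mem_inner_parallel_body elim!: set_plus_elim)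

text \<open>An intersection of translates of \<open>A\<close> inherits closedness and convexity from \<open>A\<close>.\<close>

lemma inner_parallel_body_Inter:
  "inner_parallel_body A r = (\<Inter>b\<in>cball 0 r. (\<lambda>x. x - b) ` A)"
proof -
  have "t + b \<in> A \<longleftrightarrow> t \<in> (\<lambda>x. x - b) ` A" for t b
    by (auto intro: image_eqI[where x = "t + b"])
  then show ?thesis
    unfolding set_eq_iff mem_inner_parallel_body INT_iff Ball_def mem_cball_0 by blast
qed

lemma inner_parallel_body_in_convex_bodies:
  assumes A: "A \<in> convex_bodies" and r: "0 \<le> r" and ne: "inner_parallel_body A r \<noteq> {}"
  shows "inner_parallel_body A r \<in> convex_bodies"
proof -
  have "convex A" "compact A"
    using A by (auto simp: convex_bodies_def)
  then have "convex (inner_parallel_body A r)"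
    unfolding inner_parallel_body_Inter by (intro convex_INT convex_translation_subtract)
  moreover have "closed (inner_parallel_body A r)"
    unfolding inner_parallel_body_Inter using \<open>compact A\<close>
    by (intro closed_INT ballI closed_translation_subtract compact_imp_closed)
  then have "compact (inner_parallel_body A r)"
    using \<open>compact A\<close> inner_parallel_body_subset[OF r, of A]
    by (meson bounded_subset compact_eq_bounded_closed)
  ultimately show ?thesis
    using ne by (simp add: convex_bodies_def)
qed

text \<open>Cancelling the ball determines the complementary summand, which makes decompositions with a
  given radius unique.\<close>

lemma inner_parallel_body_plus_cball:
  assumes B: "B \<in> convex_bodies" and r: "0 \<le> r"
  shows "inner_parallel_body (B + cball 0 r) r = B"
proof
  show "inner_parallel_body (B + cball 0 r) r \<subseteq> B"
  proof
    fix t assume t: "t \<in> inner_parallel_body (B + cball 0 r) r"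
    show "t \<in> B"
    proof (rule minkowski_cancellation)
      show "closed B" "convex B"
        using B by (auto simp: convex_bodies_def compact_imp_closed)
      show "t + d \<in> B + cball 0 r" if "d \<in> cball 0 r" for d
        using t that by (simp add: mem_inner_parallel_body)
    qed (use r in auto)
  qed
  show "B \<subseteq> inner_parallel_body (B + cball 0 r) r"
    unfolding subset_iff mem_inner_parallel_body by (intro allI impI set_plus_intro) simp_all
qed

text \<open>In this form regular radii add up along nested decompositions, since radii of centred balls
  do.\<close>

lemma regular_radii_eq:
  assumes "A \<in> convex_bodies"
  shows "regular_radii A = {r. 0 \<le> r \<and> (\<exists>K\<in>convex_bodies. A = K + cball 0 r)}"
proof (intro equalityI subsetI)
  fix r assume "r \<in> regular_radii A"
  then show "r \<in> {r. 0 \<le> r \<and> (\<exists>K\<in>convex_bodies. A = K + cball 0 r)}"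
    using inner_parallel_body_in_convex_bodies[OF assms] unfolding regular_radii_def by blast
next
  fix r assume "r \<in> {r. 0 \<le> r \<and> (\<exists>K\<in>convex_bodies. A = K + cball 0 r)}"
  then obtain K where K: "0 \<le> r" "K \<in> convex_bodies" "A = K + cball 0 r"
    by auto
  then have "inner_parallel_body A r = K"
    using inner_parallel_body_plus_cball by metis
  moreover have "K \<noteq> {}"
    using K(2) by (simp add: convex_bodies_def)
  ultimately show "r \<in> regular_radii A"
    using K(1,3) by (simp only: regular_radii_def mem_Collect_eq) simp
qed

section \<open>The largest regular radius\<close>

lemma zero_in_regular_radii:
  assumes "A \<in> convex_bodies"
  shows "0 \<in> regular_radii A"
  using assms by (simp add: regular_radii_def inner_parallel_body_0 convex_bodies_def)

lemma bdd_above_regular_radii: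
  fixes A :: "(real ^ 'n) set"
  assumes "A \<in> convex_bodies"
  shows "bdd_above (regular_radii A)"
proof (rule bdd_aboveI)
  fix r assume "r \<in> regular_radii A"
  then obtain t where r: "0 \<le> r" and t: "t \<in> inner_parallel_body A r"
    by (auto simp: regular_radii_def)
  obtain u :: "real ^ 'n" where u: "norm u = r"
    using vector_choose_size[OF r] by blast
  have "t \<in> A" "t + u \<in> A"
    using t u inner_parallel_body_subset[OF r, of A] by (auto simp: mem_inner_parallel_body)
  then have "dist t (t + u) \<le> diameter A"
    using assms by (simp add: convex_bodies_def compact_imp_bounded diameter_bounded_bound)
  then show "r \<le> diameter A"
    by (simp add: u dist_norm)
qed

lemma regular_radius_le_max:
  assumes "A \<in> convex_bodies" "r \<in> regular_radii A"
  shows "r \<le> max_regular_radius A"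
  unfolding max_regular_radius_def
  using assms by (intro cSup_upper bdd_above_regular_radii)

text \<open>A point of \<open>A\<close> lies in a ball of radius \<open>r\<close> inside \<open>A\<close> for each regular radius \<open>r\<close>. Along
  regular radii tending to their supremum, a subsequence of the centres of these balls converges;
  the limit is the centre of a ball inside \<open>A\<close> whose radius is the supremum.\<close>

lemma max_regular_radius_regular:
  fixes A :: "(real ^ 'n) set"
  assumes A: "A \<in> convex_bodies"
  shows "max_regular_radius A \<in> regular_radii A"
proof (cases "max_regular_radius A = 0")
  case True
  then show ?thesis using zero_in_regular_radii[OF A] by simp
next
  case False
  define m where "m = max_regular_radius A"
  have m: "0 < m"
    using False regular_radius_le_max[OF A zero_in_regular_radii[OF A]] by (simp add: m_def)
  have "m \<in> closure (regular_radii A)"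
    unfolding m_def max_regular_radius_def
    using zero_in_regular_radii[OF A] bdd_above_regular_radii[OF A]
    by (intro closure_contains_Sup) auto
  then obtain \<rho> where \<rho>: "\<And>n. \<rho> n \<in> regular_radii A" and lim_\<rho>: "\<rho> \<longlonglongrightarrow> m"
    by (auto simp: closure_sequential)
  have \<rho>_le: "\<rho> n \<le> m" and \<rho>_ge: "0 \<le> \<rho> n" for n
    using regular_radius_le_max[OF A \<rho>] \<rho> by (auto simp: m_def regular_radii_def)
  have "compact A" "A \<noteq> {}"
    using A by (auto simp: convex_bodies_def)
  have cover: "A \<subseteq> inner_parallel_body A m + cball 0 m"
  proof
    fix x assume "x \<in> A"
    have "\<exists>t. t \<in> inner_parallel_body A (\<rho> n) \<and> norm (x - t) \<le> \<rho> n" for n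
    proof -
      have "x \<in> inner_parallel_body A (\<rho> n) + cball 0 (\<rho> n)"
        using \<open>x \<in> A\<close> \<rho>[of n] unfolding regular_radii_def by blast
      then show ?thesis
        by (auto elim!: set_plus_elim)
    qed
    then obtain t where t: "\<And>n. t n \<in> inner_parallel_body A (\<rho> n)" "\<And>n. norm (x - t n) \<le> \<rho> n"
      by metis
    have "\<forall>n. t n \<in> A"
      using t(1) inner_parallel_body_subset[OF \<rho>_ge] by blast
    then obtain l \<sigma> where \<sigma>: "strict_mono (\<sigma> :: nat \<Rightarrow> nat)" and lim_t: "(t \<circ> \<sigma>) \<longlonglongrightarrow> l"
      using \<open>compact A\<close> unfolding compact_eq_seq_compact_metric seq_compact_def by blast
    have lim_\<rho>\<sigma>: "(\<lambda>n. \<rho> (\<sigma> n)) \<longlonglongrightarrow> m"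
      using LIMSEQ_subseq_LIMSEQ[OF lim_\<rho> \<sigma>] by (simp add: o_def)
    have lim_t\<sigma>: "(\<lambda>n. t (\<sigma> n)) \<longlonglongrightarrow> l"
      using lim_t by (simp add: o_def)
    have "l \<in> inner_parallel_body A m"
      unfolding mem_inner_parallel_body
    proof (intro allI impI)
      fix b :: "real ^ 'n" assume b: "norm b \<le> m"
      \<comment> \<open>Rescaling \<open>b\<close> puts it into the smaller balls, where membership in \<open>A\<close> is known.\<close>
      have "t (\<sigma> n) + (\<rho> (\<sigma> n) / m) *\<^sub>R b \<in> A" for n
      proof -
        have "\<rho> (\<sigma> n) / m * norm b \<le> \<rho> (\<sigma> n)"
          using mult_left_mono[OF b \<rho>_ge[of "\<sigma> n"]] m by (simp add: field_simps)
        then have "norm ((\<rho> (\<sigma> n) / m) *\<^sub>R b) \<le> \<rho> (\<sigma> n)"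
          using \<rho>_ge[of "\<sigma> n"] m by simp
        then show ?thesis
          using t(1)[of "\<sigma> n"] by (simp add: mem_inner_parallel_body)
      qed
      moreover have "(\<lambda>n. t (\<sigma> n) + (\<rho> (\<sigma> n) / m) *\<^sub>R b) \<longlonglongrightarrow> l + (m / m) *\<^sub>R b"
        using m by (intro tendsto_intros lim_t\<sigma> lim_\<rho>\<sigma>) auto
      ultimately have "l + (m / m) *\<^sub>R b \<in> A"
        by (rule closed_sequentially[OF compact_imp_closed[OF \<open>compact A\<close>]])
      then show "l + b \<in> A" using m by simp
    qed
    moreover have "(\<lambda>n. norm (x - t (\<sigma> n))) \<longlonglongrightarrow> norm (x - l)"
      by (intro tendsto_intros lim_t\<sigma>)
    then have "norm (x - l) \<le> m"
      by (rule LIMSEQ_le_const2) (use t(2) \<rho>_le order_trans in blast)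
    ultimately have "l + (x - l) \<in> inner_parallel_body A m + cball 0 m"
      by (intro set_plus_intro) auto
    then show "x \<in> inner_parallel_body A m + cball 0 m" by simp
  qed
  then have "A = inner_parallel_body A m + cball 0 m"
    using inner_parallel_body_plus_subset by blast
  moreover have "inner_parallel_body A m \<noteq> {}"
    using cover \<open>A \<noteq> {}\<close> by (auto elim!: set_plus_elim)
  ultimately have "m \<in> regular_radii A"
    using m unfolding regular_radii_def by simp
  then show ?thesis by (simp add: m_def)
qed

section \<open>The decomposition\<close>

lemma decompose_sum:
  assumes "A \<in> convex_bodies"
  shows "fst (decompose A) + snd (decompose A) = A"
  using max_regular_radius_regular[OF assms] by (simp add: decompose_def regular_radii_def)

text \<open>If the largest regular radius \<open>m\<close> gives back \<open>A\<close> as its inner parallel body, then \<open>A\<close> absorbs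
  \<open>cball 0 m\<close>.\<close>

lemma irreducible_bodies_iff:
  "A \<in> irreducible_bodies \<longleftrightarrow> A \<in> convex_bodies \<and> regular_radii A = {0}"
proof (intro iffI conjI)
  assume irr: "A \<in> irreducible_bodies"
  define m where "m = max_regular_radius A"
  show A: "A \<in> convex_bodies"
    using irr by (simp add: irreducible_bodies_def)
  have m: "m \<in> regular_radii A"
    using max_regular_radius_regular[OF A] by (simp add: m_def)
  have "inner_parallel_body A m = A"
    using irr by (simp add: irreducible_bodies_def m_def)
  with m have "A = A + cball 0 m" "0 \<le> m"
    by (simp_all add: regular_radii_def)
  then have "m = 0"
    using absorbed_cball_trivial[OF A] by blast
  then have "r = 0" if "r \<in> regular_radii A" for r
    using regular_radius_le_max[OF A that] that by (simp add: m_def regular_radii_def)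
  then show "regular_radii A = {0}"
    using zero_in_regular_radii[OF A] by blast
next
  assume "A \<in> convex_bodies \<and> regular_radii A = {0}"
  then show "A \<in> irreducible_bodies"
    by (simp add: irreducible_bodies_def max_regular_radius_def inner_parallel_body_0)
qed

text \<open>A ball split off from the remaining body could be merged with the ball already split off, and
  would exceed the largest regular radius.\<close>

lemma decompose_in_irreducible_times_balls:
  assumes A: "A \<in> convex_bodies"
  shows "decompose A \<in> irreducible_bodies \<times> centered_balls"
proof -
  define m where "m = max_regular_radius A"
  define K where "K = inner_parallel_body A m"
  have "m \<in> regular_radii A"
    using max_regular_radius_regular[OF A] by (simp add: m_def)
  then have m: "0 \<le> m" and eq: "A = K + cball 0 m" and ne: "K \<noteq> {}"
    by (simp_all add: regular_radii_def K_def)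
  have K: "K \<in> convex_bodies"
    using inner_parallel_body_in_convex_bodies[OF A m] ne by (simp add: K_def)
  have "s = 0" if s: "s \<in> regular_radii K" for s
  proof -
    obtain L where L: "0 \<le> s" "L \<in> convex_bodies" "K = L + cball 0 s"
      using s by (auto simp: regular_radii_eq[OF K])
    then have "A = L + cball 0 (s + m)"
      using eq m by (simp add: add.assoc cball_0_plus_cball_0)
    then have "s + m \<in> regular_radii A"
      unfolding regular_radii_eq[OF A] using L(1,2) m by auto
    then have "s + m \<le> m"
      unfolding m_def by (rule regular_radius_le_max[OF A])
    with L(1) show ?thesis by simp
  qed
  then have "K \<in> irreducible_bodies"
    using K zero_in_regular_radii[OF K] by (auto simp: irreducible_bodies_iff)
  with m show ?thesis
    by (auto simp: decompose_def centered_balls_def K_def m_def)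
qed

text \<open>Cancelling \<open>cball 0 r\<close> in \<open>B + cball 0 r = K + cball 0 m\<close>, where \<open>m \<ge> r\<close> is the largest
  regular radius, shows that \<open>m - r\<close> is a regular radius of \<open>B\<close>.\<close>

lemma decompose_irreducible_plus_cball:
  assumes B: "B \<in> irreducible_bodies" and r: "0 \<le> r"
  shows "decompose (B + cball 0 r) = (B, cball 0 r)"
proof -
  define A where "A = B + cball 0 r"
  define m where "m = max_regular_radius A"
  define K where "K = inner_parallel_body A m"
  have Bc: "B \<in> convex_bodies" and rad_B: "regular_radii B = {0}"
    using B by (auto simp: irreducible_bodies_iff)
  have A: "A \<in> convex_bodies"
    unfolding A_def by (intro convex_bodies_plus Bc cball_in_convex_bodies r)
  have "r \<in> regular_radii A"
    unfolding regular_radii_eq[OF A] using A_def Bc r by blast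
  then have rm: "r \<le> m"
    using regular_radius_le_max[OF A] by (simp add: m_def)
  have "m \<in> regular_radii A"
    using max_regular_radius_regular[OF A] by (simp add: m_def)
  then have eq: "A = K + cball 0 m" and ne: "K \<noteq> {}"
    by (simp_all add: regular_radii_def K_def)
  have K: "K \<in> convex_bodies"
    using inner_parallel_body_in_convex_bodies[OF A] ne r rm by (simp add: K_def)
  have "A = (K + cball 0 (m - r)) + cball 0 r"
    using eq r rm by (simp add: add.assoc cball_0_plus_cball_0)
  moreover have "K + cball 0 (m - r) \<in> convex_bodies"
    using rm by (intro convex_bodies_plus K cball_in_convex_bodies) simp
  ultimately have "B = K + cball 0 (m - r)"
    using inner_parallel_body_plus_cball[OF _ r] Bc unfolding A_def by metis
  then have "m - r \<in> regular_radii B"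
    unfolding regular_radii_eq[OF Bc] using K rm by auto
  then have "m = r"
    by (simp add: rad_B)
  then show ?thesis
    using inner_parallel_body_plus_cball[OF Bc r] by (simp add: decompose_def m_def A_def)
qed

theorem theorem3p3p4:
  shows "(\<forall>A \<in> (convex_bodies :: (real ^ 'n) set set).
            \<exists>!p. p \<in> irreducible_bodies \<times> centered_balls \<and> A = fst p + snd p)
       \<and> bij_betw decompose (convex_bodies :: (real ^ 'n) set set)
            (irreducible_bodies \<times> centered_balls)
       \<and> (\<forall>A \<in> (convex_bodies :: (real ^ 'n) set set).
            fst (decompose A) + snd (decompose A) = A)
       \<and> (\<forall>B \<in> (irreducible_bodies :: (real ^ 'n) set set). \<forall>C \<in> centered_balls.
            B + C \<in> convex_bodies \<and> decompose (B + C) = (B, C))"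
proof -
  have inv: "B + C \<in> convex_bodies \<and> decompose (B + C) = (B, C)"
    if B: "B \<in> irreducible_bodies" and C: "C \<in> centered_balls" for B C :: "(real ^ 'n) set"
  proof -
    obtain r where r: "0 \<le> r" "C = cball 0 r"
      using C by (auto simp: centered_balls_def)
    moreover have "B \<in> convex_bodies"
      using B by (simp add: irreducible_bodies_def)
    ultimately show ?thesis
      using B convex_bodies_plus cball_in_convex_bodies decompose_irreducible_plus_cball
      by blast
  qed
  have "\<exists>!p. p \<in> irreducible_bodies \<times> centered_balls \<and> A = fst p + snd p"
    if A: "A \<in> convex_bodies" for A :: "(real ^ 'n) set"
  proof (rule ex1I[of _ "decompose A"])
    show "decompose A \<in> irreducible_bodies \<times> centered_balls
        \<and> A = fst (decompose A) + snd (decompose A)"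
      using decompose_in_irreducible_times_balls[OF A] decompose_sum[OF A] by simp
    show "p = decompose A" if "p \<in> irreducible_bodies \<times> centered_balls \<and> A = fst p + snd p" for p
      using that inv by (auto simp: mem_Times_iff)
  qed
  moreover have "bij_betw decompose (convex_bodies :: (real ^ 'n) set set)
      (irreducible_bodies \<times> centered_balls)"
  proof (rule bij_betw_byWitness[where f' = "\<lambda>p. fst p + snd p"])
    show "decompose ` convex_bodies \<subseteq> irreducible_bodies \<times> centered_balls"
      using decompose_in_irreducible_times_balls by blast
  qed (use inv decompose_sum in auto)
  ultimately show ?thesis
    by (intro conjI ballI) (simp_all only: inv decompose_sum)
qed

end
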